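(* Let $R$ be a semisimple artinian ring, and let $M$ be a finitely generated right $R$-module. Then $M$ is centrally morphic if and only if it is centrally quasi-morphic.
   Context: Rings are associative with identity, modules are unital right modules, and $S=\operatorname{End}_R(M)$. $M$ is centrally quasi-morphic if for every $f\in S$ there exist $g,h$ in the center of $S$ such that $\ker(f)=\operatorname{Im}(g)$ and $\operatorname{Im}(f)=\ker(h)$; $M$ is centrally morphic if for every $f\in S$ one can choose $g=h$, i.e. there is $g$ in the center of $S$ with $\ker(f)=\operatorname{Im}(g)$ and $\operatorname{Im}(f)=\ker(g)$. *)

theory Defs
  imports "HOL-Algebra.Module" "HOL-Algebra.AbelCoset"
begin

text \<open>
  The library locale \<open>module\<close> requires a commutative ring of scalars.  Here the library record of
  modules is reused for unital right modules over an arbitrary ring: \<open>a \<odot>\<^bsub>M\<^esub> x\<close> denotes the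
  right action \<open>x \<cdot> a\<close>, which is why the factors are swapped in \<open>rsmult_assoc\<close>.
  The library locale \<open>submodule\<close> does not depend on commutativity (nor on the side) and is used as
  it stands.
\<close>

locale right_module = R?: ring R + M?: abelian_group M
  for R (structure) and M (structure) +
  assumes rsmult_closed [simp, intro]:
      "\<lbrakk>a \<in> carrier R; x \<in> carrier M\<rbrakk> \<Longrightarrow> a \<odot>\<^bsub>M\<^esub> x \<in> carrier M"
    and rsmult_scalar_distr:
      "\<lbrakk>a \<in> carrier R; b \<in> carrier R; x \<in> carrier M\<rbrakk> \<Longrightarrow>
        (a \<oplus>\<^bsub>R\<^esub> b) \<odot>\<^bsub>M\<^esub> x = a \<odot>\<^bsub>M\<^esub> x \<oplus>\<^bsub>M\<^esub> b \<odot>\<^bsub>M\<^esub> x"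
    and rsmult_vector_distr:
      "\<lbrakk>a \<in> carrier R; x \<in> carrier M; y \<in> carrier M\<rbrakk> \<Longrightarrow>
        a \<odot>\<^bsub>M\<^esub> (x \<oplus>\<^bsub>M\<^esub> y) = a \<odot>\<^bsub>M\<^esub> x \<oplus>\<^bsub>M\<^esub> a \<odot>\<^bsub>M\<^esub> y"
    and rsmult_assoc:
      "\<lbrakk>a \<in> carrier R; b \<in> carrier R; x \<in> carrier M\<rbrakk> \<Longrightarrow>
        (a \<otimes>\<^bsub>R\<^esub> b) \<odot>\<^bsub>M\<^esub> x = b \<odot>\<^bsub>M\<^esub> (a \<odot>\<^bsub>M\<^esub> x)"
    and rsmult_one [simp]:
      "x \<in> carrier M \<Longrightarrow> \<one>\<^bsub>R\<^esub> \<odot>\<^bsub>M\<^esub> x = x"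

definition generated_submodule ::
    "('a, 'r) ring_scheme \<Rightarrow> ('a, 'b, 'm) module_scheme \<Rightarrow> 'b set \<Rightarrow> 'b set" where
  "generated_submodule R M A = \<Inter> {N. submodule N R M \<and> A \<subseteq> N}"

definition finitely_generated_module ::
    "('a, 'r) ring_scheme \<Rightarrow> ('a, 'b, 'm) module_scheme \<Rightarrow> bool" where
  "finitely_generated_module R M \<longleftrightarrow>
     (\<exists>A. finite A \<and> A \<subseteq> carrier M \<and> generated_submodule R M A = carrier M)"

definition simple_submodule ::
    "'b set \<Rightarrow> ('a, 'r) ring_scheme \<Rightarrow> ('a, 'b, 'm) module_scheme \<Rightarrow> bool" where
  "simple_submodule N R M \<longleftrightarrow>
     submodule N R M \<and> N \<noteq> {\<zero>\<^bsub>M\<^esub>} \<and>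
     (\<forall>K. submodule K R M \<and> K \<subseteq> N \<longrightarrow> K = {\<zero>\<^bsub>M\<^esub>} \<or> K = N)"

text \<open>A module is semisimple if it is the sum of its simple submodules.\<close>

definition semisimple_module ::
    "('a, 'r) ring_scheme \<Rightarrow> ('a, 'b, 'm) module_scheme \<Rightarrow> bool" where
  "semisimple_module R M \<longleftrightarrow>
     generated_submodule R M (\<Union> {N. simple_submodule N R M}) = carrier M"

definition artinian_module ::
    "('a, 'r) ring_scheme \<Rightarrow> ('a, 'b, 'm) module_scheme \<Rightarrow> bool" where
  "artinian_module R M \<longleftrightarrow>
     (\<forall>N :: nat \<Rightarrow> 'b set.
        (\<forall>n. submodule (N n) R M) \<and> (\<forall>n. N (Suc n) \<subseteq> N n) \<longrightarrow>
        (\<exists>m. \<forall>n\<ge>m. N n = N m))"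

text \<open>The ring as a right module over itself; its submodules are the right ideals.\<close>

definition regular_right_module :: "('a, 'r) ring_scheme \<Rightarrow> ('a, 'a) module" where
  "regular_right_module R =
     \<lparr>carrier = carrier R, mult = mult R, one = \<one>\<^bsub>R\<^esub>, zero = \<zero>\<^bsub>R\<^esub>, add = add R,
      smult = (\<lambda>a x. x \<otimes>\<^bsub>R\<^esub> a)\<rparr>"

definition semisimple_artinian_ring :: "('a, 'r) ring_scheme \<Rightarrow> bool" where
  "semisimple_artinian_ring R \<longleftrightarrow>
     ring R \<and> semisimple_module R (regular_right_module R) \<and>
     artinian_module R (regular_right_module R)"

text \<open>
  Endomorphisms are represented by extensional functions, so that two of them are equal exactly
  if they agree on the carrier.
\<close>

definition module_End ::
    "('a, 'r) ring_scheme \<Rightarrow> ('a, 'b, 'm) module_scheme \<Rightarrow> ('b \<Rightarrow> 'b) set" where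
  "module_End R M =
     {f \<in> carrier M \<rightarrow>\<^sub>E carrier M.
        (\<forall>x\<in>carrier M. \<forall>y\<in>carrier M. f (x \<oplus>\<^bsub>M\<^esub> y) = f x \<oplus>\<^bsub>M\<^esub> f y) \<and>
        (\<forall>a\<in>carrier R. \<forall>x\<in>carrier M. f (a \<odot>\<^bsub>M\<^esub> x) = a \<odot>\<^bsub>M\<^esub> f x)}"

definition End_ring ::
    "('a, 'r) ring_scheme \<Rightarrow> ('a, 'b, 'm) module_scheme \<Rightarrow> ('b \<Rightarrow> 'b) ring" where
  "End_ring R M =
     \<lparr>carrier = module_End R M,
      mult = compose (carrier M),
      one = (\<lambda>x\<in>carrier M. x),
      zero = (\<lambda>x\<in>carrier M. \<zero>\<^bsub>M\<^esub>),
      add = (\<lambda>f g. \<lambda>x\<in>carrier M. f x \<oplus>\<^bsub>M\<^esub> g x)\<rparr>"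

definition ring_center :: "('a, 'r) ring_scheme \<Rightarrow> 'a set" where
  "ring_center S = {z \<in> carrier S. \<forall>s\<in>carrier S. z \<otimes>\<^bsub>S\<^esub> s = s \<otimes>\<^bsub>S\<^esub> z}"

definition centrally_quasi_morphic ::
    "('a, 'r) ring_scheme \<Rightarrow> ('a, 'b, 'm) module_scheme \<Rightarrow> bool" where
  "centrally_quasi_morphic R M \<longleftrightarrow>
     (\<forall>f\<in>carrier (End_ring R M).
        \<exists>g\<in>ring_center (End_ring R M). \<exists>h\<in>ring_center (End_ring R M).
          a_kernel M M f = g ` carrier M \<and> f ` carrier M = a_kernel M M h)"

definition centrally_morphic ::
    "('a, 'r) ring_scheme \<Rightarrow> ('a, 'b, 'm) module_scheme \<Rightarrow> bool" where
  "centrally_morphic R M \<longleftrightarrow>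
     (\<forall>f\<in>carrier (End_ring R M).
        \<exists>g\<in>ring_center (End_ring R M).
          a_kernel M M f = g ` carrier M \<and> f ` carrier M = a_kernel M M g)"

lemma right_module_regular:
  assumes "ring R"
  shows "right_module R (regular_right_module R)"
proof -
  interpret ring R by fact
  have "abelian_group (regular_right_module R)"
    by (rule abelian_groupI)
       (use l_neg in \<open>auto simp: regular_right_module_def a_ac\<close>)
  then show ?thesis
    by (intro right_module.intro right_module_axioms.intro)
       (auto simp: regular_right_module_def assms l_distr r_distr m_assoc)
qed

lemma (in right_module) ring_End_ring: "ring (End_ring R M)"
proof (rule ringI)
  have rz: "a \<odot>\<^bsub>M\<^esub> \<zero>\<^bsub>M\<^esub> = \<zero>\<^bsub>M\<^esub>" if "a \<in> carrier R" for a
    using rsmult_vector_distr[of a "\<zero>\<^bsub>M\<^esub>" "\<zero>\<^bsub>M\<^esub>"] that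
    by (metis M.add.r_cancel_one M.zero_closed M.l_zero rsmult_closed)
  have neg: "\<exists>g\<in>carrier (End_ring R M). g \<oplus>\<^bsub>End_ring R M\<^esub> f = \<zero>\<^bsub>End_ring R M\<^esub>"
    if f: "f \<in> carrier (End_ring R M)" for f
  proof
    have rsmult_minus: "a \<odot>\<^bsub>M\<^esub> (\<ominus>\<^bsub>M\<^esub> x) = \<ominus>\<^bsub>M\<^esub> (a \<odot>\<^bsub>M\<^esub> x)"
      if "a \<in> carrier R" "x \<in> carrier M" for a x
      using rsmult_vector_distr[of a "\<ominus>\<^bsub>M\<^esub> x" x] rz[of a] that
      by (metis M.a_inv_closed M.l_neg M.minus_equality rsmult_closed)
    let ?g = "\<lambda>x\<in>carrier M. \<ominus>\<^bsub>M\<^esub> f x"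
    show "?g \<in> carrier (End_ring R M)"
      using f by (auto simp: End_ring_def module_End_def PiE_iff M.minus_add rsmult_minus)
    show "?g \<oplus>\<^bsub>End_ring R M\<^esub> f = \<zero>\<^bsub>End_ring R M\<^esub>"
      using f by (auto simp: End_ring_def module_End_def PiE_iff M.l_neg)
  qed
  show "abelian_group (End_ring R M)"
    by (rule abelian_groupI)
       (use neg in \<open>auto simp: End_ring_def module_End_def PiE_iff M.a_ac rsmult_vector_distr rz
          extensional_def restrict_def fun_eq_iff\<close>)
  show "Group.monoid (End_ring R M)"
    by (rule monoidI)
       (auto simp: End_ring_def module_End_def PiE_iff compose_def extensional_def fun_eq_iff)
qed (auto simp: End_ring_def module_End_def PiE_iff compose_def fun_eq_iff)

end

theory Submission
  imports Defs
begin

text \<open>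
  Over a semisimple ring every submodule of \<open>M\<close> has a complement, so every endomorphism \<open>f\<close> has a
  quasi-inverse \<open>p\<close> with \<open>f p f = f\<close>.  If \<open>M\<close> is centrally quasi-morphic, then kernels and images of
  endomorphisms are fully invariant, so all idempotents of the endomorphism ring are central.
  Hence \<open>p f\<close> and \<open>f p\<close> are central idempotents, which forces \<open>p f = f p\<close>, and \<open>g = 1 - p f\<close>
  satisfies \<open>ker f = Im g\<close> and \<open>Im f = ker g\<close>.
\<close>

section \<open>Module arithmetic, submodules and their sums\<close>

lemma set_addI: "n \<in> N \<Longrightarrow> c \<in> C \<Longrightarrow> n \<oplus>\<^bsub>M\<^esub> c \<in> N <+>\<^bsub>M\<^esub> C"
  by (auto simp: set_add_def')

lemma set_addE:
  assumes "x \<in> N <+>\<^bsub>M\<^esub> C"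
  obtains n c where "n \<in> N" "c \<in> C" "x = n \<oplus>\<^bsub>M\<^esub> c"
  using assms by (auto simp: set_add_def')

context right_module
begin

lemma rsmult_zero_right [simp]: "a \<in> carrier R \<Longrightarrow> a \<odot>\<^bsub>M\<^esub> \<zero>\<^bsub>M\<^esub> = \<zero>\<^bsub>M\<^esub>"
  using rsmult_vector_distr[of a "\<zero>\<^bsub>M\<^esub>" "\<zero>\<^bsub>M\<^esub>"]
  by (metis M.add.r_cancel_one M.zero_closed M.l_zero rsmult_closed)

lemma rsmult_zero_left [simp]: "x \<in> carrier M \<Longrightarrow> \<zero>\<^bsub>R\<^esub> \<odot>\<^bsub>M\<^esub> x = \<zero>\<^bsub>M\<^esub>"
  using rsmult_scalar_distr[of "\<zero>\<^bsub>R\<^esub>" "\<zero>\<^bsub>R\<^esub>" x]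
  by (metis M.add.r_cancel_one R.zero_closed R.l_zero rsmult_closed)

lemma rsmult_minus_left:
  "a \<in> carrier R \<Longrightarrow> x \<in> carrier M \<Longrightarrow> (\<ominus>\<^bsub>R\<^esub> a) \<odot>\<^bsub>M\<^esub> x = \<ominus>\<^bsub>M\<^esub> (a \<odot>\<^bsub>M\<^esub> x)"
  using rsmult_scalar_distr[of "\<ominus>\<^bsub>R\<^esub> a" a x]
  by (metis M.minus_equality R.a_inv_closed R.l_neg rsmult_closed rsmult_zero_left)

lemma eq_if_diff_zero:
  "x \<oplus>\<^bsub>M\<^esub> \<ominus>\<^bsub>M\<^esub> y = \<zero>\<^bsub>M\<^esub> \<Longrightarrow> x \<in> carrier M \<Longrightarrow> y \<in> carrier M \<Longrightarrow> x = y"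
  using M.minus_equality[of x "\<ominus>\<^bsub>M\<^esub> y"] by simp

text \<open>Acting by the negative of the identity of \<open>R\<close> gives additive inverses, so
  closure under negation does not appear among the premises.\<close>

lemma right_submoduleI:
  assumes "H \<subseteq> carrier M" "\<zero>\<^bsub>M\<^esub> \<in> H"
    and add: "\<And>x y. x \<in> H \<Longrightarrow> y \<in> H \<Longrightarrow> x \<oplus>\<^bsub>M\<^esub> y \<in> H"
    and smult: "\<And>a x. a \<in> carrier R \<Longrightarrow> x \<in> H \<Longrightarrow> a \<odot>\<^bsub>M\<^esub> x \<in> H"
  shows "submodule H R M"
proof -
  have "\<ominus>\<^bsub>M\<^esub> x \<in> H" if "x \<in> H" for x
    using smult[of "\<ominus>\<^bsub>R\<^esub> \<one>\<^bsub>R\<^esub>" x] that assms(1) by (auto simp: rsmult_minus_left)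
  then show ?thesis
    using assms by (intro submodule.intro subgroup.intro submodule_axioms.intro)
      (auto simp: a_inv_def)
qed

lemma right_submoduleE:
  assumes "submodule H R M"
  shows "H \<subseteq> carrier M" "\<zero>\<^bsub>M\<^esub> \<in> H"
    and "\<And>x y. x \<in> H \<Longrightarrow> y \<in> H \<Longrightarrow> x \<oplus>\<^bsub>M\<^esub> y \<in> H"
    and "\<And>x. x \<in> H \<Longrightarrow> \<ominus>\<^bsub>M\<^esub> x \<in> H"
    and "\<And>a x. a \<in> carrier R \<Longrightarrow> x \<in> H \<Longrightarrow> a \<odot>\<^bsub>M\<^esub> x \<in> H"
proof -
  interpret H: submodule H R M by fact
  show "H \<subseteq> carrier M" "\<zero>\<^bsub>M\<^esub> \<in> H" using H.subset H.one_closed by auto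
  show "x \<oplus>\<^bsub>M\<^esub> y \<in> H" if "x \<in> H" "y \<in> H" for x y using H.m_closed that by auto
  show "\<ominus>\<^bsub>M\<^esub> x \<in> H" if "x \<in> H" for x using H.m_inv_closed that by (auto simp: a_inv_def)
  show "a \<odot>\<^bsub>M\<^esub> x \<in> H" if "a \<in> carrier R" "x \<in> H" for a x using that by auto
qed

lemma submodule_set_add:
  assumes "submodule N R M" "submodule C R M"
  shows "submodule (N <+>\<^bsub>M\<^esub> C) R M" "N \<subseteq> N <+>\<^bsub>M\<^esub> C" "C \<subseteq> N <+>\<^bsub>M\<^esub> C"
proof -
  note N = right_submoduleE[OF assms(1)] and C = right_submoduleE[OF assms(2)]
  show "submodule (N <+>\<^bsub>M\<^esub> C) R M"
  proof (rule right_submoduleI)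
    show "N <+>\<^bsub>M\<^esub> C \<subseteq> carrier M" using N(1) C(1) by (auto simp: set_add_def')
    show "\<zero>\<^bsub>M\<^esub> \<in> N <+>\<^bsub>M\<^esub> C" using set_addI[OF N(2) C(2), of M] by simp
  next
    fix x y assume "x \<in> N <+>\<^bsub>M\<^esub> C" "y \<in> N <+>\<^bsub>M\<^esub> C"
    then obtain n c n' c' where *: "n \<in> N" "c \<in> C" "x = n \<oplus>\<^bsub>M\<^esub> c"
      "n' \<in> N" "c' \<in> C" "y = n' \<oplus>\<^bsub>M\<^esub> c'" by (elim set_addE)
    have "x \<oplus>\<^bsub>M\<^esub> y = (n \<oplus>\<^bsub>M\<^esub> n') \<oplus>\<^bsub>M\<^esub> (c \<oplus>\<^bsub>M\<^esub> c')"
      using * N(1) C(1) by (simp add: subset_iff M.a_ac)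
    then show "x \<oplus>\<^bsub>M\<^esub> y \<in> N <+>\<^bsub>M\<^esub> C"
      using * N(3) C(3) by (simp add: set_addI)
  next
    fix a x assume a: "a \<in> carrier R" and "x \<in> N <+>\<^bsub>M\<^esub> C"
    then obtain n c where *: "n \<in> N" "c \<in> C" "x = n \<oplus>\<^bsub>M\<^esub> c" by (elim set_addE)
    have "a \<odot>\<^bsub>M\<^esub> x = a \<odot>\<^bsub>M\<^esub> n \<oplus>\<^bsub>M\<^esub> a \<odot>\<^bsub>M\<^esub> c"
      using * a N(1) C(1) by (simp add: subset_iff rsmult_vector_distr)
    then show "a \<odot>\<^bsub>M\<^esub> x \<in> N <+>\<^bsub>M\<^esub> C"
      using * a N(5) C(5) by (simp add: set_addI)
  qed
  show "N \<subseteq> N <+>\<^bsub>M\<^esub> C"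
  proof
    fix n assume n: "n \<in> N"
    then show "n \<in> N <+>\<^bsub>M\<^esub> C" using set_addI[OF n C(2), of M] N(1) by auto
  qed
  show "C \<subseteq> N <+>\<^bsub>M\<^esub> C"
  proof
    fix c assume c: "c \<in> C"
    then show "c \<in> N <+>\<^bsub>M\<^esub> C" using set_addI[OF N(2) c, of M] C(1) by auto
  qed
qed

text \<open>Rearranging the equation shows that the difference of \<open>n\<close> and
  \<open>n'\<close> equals that of \<open>c'\<close> and \<open>c\<close>; it therefore lies in both
  \<open>N\<close> and \<open>C\<close> and vanishes.\<close>

lemma decomposition_unique:
  assumes "submodule N R M" "submodule C R M" "N \<inter> C = {\<zero>\<^bsub>M\<^esub>}"
    and "n \<in> N" "n' \<in> N" "c \<in> C" "c' \<in> C" "n \<oplus>\<^bsub>M\<^esub> c = n' \<oplus>\<^bsub>M\<^esub> c'"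
  shows "n = n'" "c = c'"
proof -
  note N = right_submoduleE[OF assms(1)] and C = right_submoduleE[OF assms(2)]
  have cl: "n \<in> carrier M" "n' \<in> carrier M" "c \<in> carrier M" "c' \<in> carrier M"
    using assms N(1) C(1) by auto
  have "n = (n \<oplus>\<^bsub>M\<^esub> c) \<oplus>\<^bsub>M\<^esub> \<ominus>\<^bsub>M\<^esub> c"
    using cl by (simp add: M.a_assoc M.r_neg)
  also have "\<dots> = n' \<oplus>\<^bsub>M\<^esub> (c' \<oplus>\<^bsub>M\<^esub> \<ominus>\<^bsub>M\<^esub> c)"
    unfolding assms(8) using cl by (simp add: M.a_assoc)
  finally have eq: "\<ominus>\<^bsub>M\<^esub> n' \<oplus>\<^bsub>M\<^esub> n = c' \<oplus>\<^bsub>M\<^esub> \<ominus>\<^bsub>M\<^esub> c"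
    using cl by (simp add: M.r_neg1)
  have "\<ominus>\<^bsub>M\<^esub> n' \<oplus>\<^bsub>M\<^esub> n \<in> N"
    using assms N(3,4) by blast
  moreover have "\<ominus>\<^bsub>M\<^esub> n' \<oplus>\<^bsub>M\<^esub> n \<in> C"
    unfolding eq using assms C(3,4) by blast
  ultimately have "\<ominus>\<^bsub>M\<^esub> n' \<oplus>\<^bsub>M\<^esub> n = \<zero>\<^bsub>M\<^esub>" using assms(3) by blast
  then have "n \<oplus>\<^bsub>M\<^esub> \<ominus>\<^bsub>M\<^esub> n' = \<zero>\<^bsub>M\<^esub>" using cl by (simp add: M.a_comm)
  from this cl(1,2) show "n = n'" by (rule eq_if_diff_zero)
  then show "c = c'" using assms(8) cl by simp
qed

section \<open>Complements over a semisimple ring\<close>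

text \<open>Two elements of the union lie in a common member of the chain, where they can be added.
  This supplies the upper bounds for Zorn's lemma in \<open>ex_complement\<close>.\<close>

lemma submodule_Union_chain:
  assumes "\<A> \<noteq> {}" and "\<And>C. C \<in> \<A> \<Longrightarrow> submodule C R M"
    and chain: "\<And>C D. C \<in> \<A> \<Longrightarrow> D \<in> \<A> \<Longrightarrow> C \<subseteq> D \<or> D \<subseteq> C"
  shows "submodule (\<Union>\<A>) R M"
proof (rule right_submoduleI)
  note sub = right_submoduleE[OF assms(2)]
  show "\<Union>\<A> \<subseteq> carrier M" "\<zero>\<^bsub>M\<^esub> \<in> \<Union>\<A>" using sub(1,2) assms(1) by blast+
  show "a \<odot>\<^bsub>M\<^esub> x \<in> \<Union>\<A>" if "a \<in> carrier R" "x \<in> \<Union>\<A>" for a x using that sub(5) by blast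
  fix x y assume "x \<in> \<Union>\<A>" "y \<in> \<Union>\<A>"
  then obtain C D where "C \<in> \<A>" "D \<in> \<A>" "x \<in> C" "y \<in> D" by blast
  then show "x \<oplus>\<^bsub>M\<^esub> y \<in> \<Union>\<A>" using chain[of C D] sub(3) by blast
qed

text \<open>The witness is \<open>x I\<close> for some \<open>x \<notin> Q\<close> and a simple right ideal \<open>I\<close> with \<open>x I\<close> not
  contained in \<open>Q\<close>, which exists as the simple right ideals generate \<open>R\<close>.\<close>

lemma ex_submodule_disjoint:
  assumes R: "semisimple_module R (regular_right_module R)"
    and Q: "submodule Q R M" "Q \<noteq> carrier M"
  obtains T where "submodule T R M" "T \<noteq> {\<zero>\<^bsub>M\<^esub>}" "T \<inter> Q = {\<zero>\<^bsub>M\<^esub>}"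
proof -
  interpret reg: right_module R "regular_right_module R"
    by (rule right_module_regular) (rule R.ring_axioms)
  have reg_simps [simp]: "carrier (regular_right_module R) = carrier R"
    "\<zero>\<^bsub>regular_right_module R\<^esub> = \<zero>\<^bsub>R\<^esub>" "(\<oplus>\<^bsub>regular_right_module R\<^esub>) = (\<oplus>\<^bsub>R\<^esub>)"
    "(\<odot>\<^bsub>regular_right_module R\<^esub>) = (\<lambda>a x. x \<otimes>\<^bsub>R\<^esub> a)"
    by (auto simp: regular_right_module_def)
  note Qs = right_submoduleE[OF Q(1)]
  obtain x where x: "x \<in> carrier M" "x \<notin> Q" using Q Qs(1) by auto
  \<comment> \<open>\<open>J\<close> is the annihilator of the class of \<open>x\<close> in the
    quotient of \<open>M\<close> by \<open>Q\<close>, hence a right ideal.\<close>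
  define J where "J = {a \<in> carrier R. a \<odot>\<^bsub>M\<^esub> x \<in> Q}"
  have J: "submodule J R (regular_right_module R)"
    by (rule reg.right_submoduleI)
      (use x Qs in \<open>auto simp: J_def rsmult_scalar_distr rsmult_assoc\<close>)
  \<comment> \<open>If \<open>J\<close> contained all simple right ideals, it would contain the
    submodule they generate, which is all of \<open>R\<close> and so includes the identity.\<close>
  have "\<one>\<^bsub>R\<^esub> \<notin> J" using x by (simp add: J_def)
  then have "\<not> generated_submodule R (regular_right_module R)
      (\<Union> {N. simple_submodule N R (regular_right_module R)}) \<subseteq> J"
    using R by (auto simp: semisimple_module_def)
  then obtain I where I: "simple_submodule I R (regular_right_module R)" "\<not> I \<subseteq> J"
    using J unfolding generated_submodule_def by blast
  then have sI: "submodule I R (regular_right_module R)" by (simp add: simple_submodule_def)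
  note Is = reg.right_submoduleE[OF sI, simplified] and Js = reg.right_submoduleE[OF J, simplified]
  \<comment> \<open>As \<open>I\<close> is simple and not inside \<open>J\<close>, the intersection
    must be zero: for \<open>a\<close> in \<open>I\<close>, the product of \<open>x\<close> by
    \<open>a\<close> falls into \<open>Q\<close> only if \<open>a\<close> is zero.\<close>
  have "submodule (I \<inter> J) R (regular_right_module R)"
    by (rule reg.right_submoduleI) (use Is Js in auto)
  then have IJ: "I \<inter> J = {\<zero>\<^bsub>R\<^esub>}" using I unfolding simple_submodule_def by auto
  define T where "T = (\<lambda>a. a \<odot>\<^bsub>M\<^esub> x) ` I"
  show thesis
  proof (rule that)
    show "submodule T R M"
    proof (rule right_submoduleI)
      show "T \<subseteq> carrier M" using Is(1) x by (auto simp: T_def)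
      show "\<zero>\<^bsub>M\<^esub> \<in> T" using Is(2) x rsmult_zero_left[of x] unfolding T_def by (metis image_eqI)
    next
      fix u v assume "u \<in> T" "v \<in> T"
      then obtain a b where ab: "a \<in> I" "b \<in> I" "u = a \<odot>\<^bsub>M\<^esub> x" "v = b \<odot>\<^bsub>M\<^esub> x"
        by (auto simp: T_def)
      then have "u \<oplus>\<^bsub>M\<^esub> v = (a \<oplus>\<^bsub>R\<^esub> b) \<odot>\<^bsub>M\<^esub> x"
        using Is(1) x by (auto simp: rsmult_scalar_distr subset_iff)
      then show "u \<oplus>\<^bsub>M\<^esub> v \<in> T" using ab Is(3) by (auto simp: T_def)
    next
      fix r u assume r: "r \<in> carrier R" and "u \<in> T"
      then obtain a where a: "a \<in> I" "u = a \<odot>\<^bsub>M\<^esub> x" by (auto simp: T_def)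
      then have "r \<odot>\<^bsub>M\<^esub> u = (a \<otimes>\<^bsub>R\<^esub> r) \<odot>\<^bsub>M\<^esub> x"
        using Is(1) x r by (auto simp: rsmult_assoc subset_iff)
      then show "r \<odot>\<^bsub>M\<^esub> u \<in> T" using a r Is(5) by (auto simp: T_def)
    qed
    then have "\<zero>\<^bsub>M\<^esub> \<in> T" by (rule right_submoduleE)
    moreover have "t = \<zero>\<^bsub>M\<^esub>" if "t \<in> T" "t \<in> Q" for t
    proof -
      obtain a where a: "a \<in> I" "t = a \<odot>\<^bsub>M\<^esub> x" using \<open>t \<in> T\<close> by (auto simp: T_def)
      then have "a \<in> I \<inter> J" using that Is(1) by (auto simp: J_def)
      then show ?thesis using a IJ x by auto
    qed
    ultimately show "T \<inter> Q = {\<zero>\<^bsub>M\<^esub>}" using Qs(2) by blast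
    obtain a where "a \<in> I" "a \<notin> J" using I(2) by auto
    then have "a \<odot>\<^bsub>M\<^esub> x \<in> T" "a \<odot>\<^bsub>M\<^esub> x \<notin> Q" using Is(1) by (auto simp: T_def J_def)
    then show "T \<noteq> {\<zero>\<^bsub>M\<^esub>}" using Qs(2) by (metis singletonD)
  qed
qed

text \<open>Zorn's lemma gives a \<open>C\<close> maximal among the submodules meeting
  \<open>N\<close> trivially. If the sum of \<open>N\<close> and \<open>C\<close> were proper, a
  nonzero \<open>T\<close> meeting that sum trivially could be added to \<open>C\<close>, against
  maximality.\<close>

lemma ex_complement:
  assumes R: "semisimple_module R (regular_right_module R)"
    and N: "submodule N R M"
  obtains C where "submodule C R M" "N \<inter> C = {\<zero>\<^bsub>M\<^esub>}" "N <+>\<^bsub>M\<^esub> C = carrier M"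
proof -
  let ?\<A> = "{C. submodule C R M \<and> N \<inter> C = {\<zero>\<^bsub>M\<^esub>}}"
  note Ns = right_submoduleE[OF N]
  have "submodule {\<zero>\<^bsub>M\<^esub>} R M" by (rule right_submoduleI) auto
  then have "{\<zero>\<^bsub>M\<^esub>} \<in> ?\<A>" using Ns(2) by auto
  then have "?\<A> \<noteq> {}" by blast
  then have "\<exists>C\<in>?\<A>. \<forall>X\<in>?\<A>. C \<subseteq> X \<longrightarrow> X = C"
  proof (rule subset_Zorn_nonempty)
    fix \<C> assume ne: "\<C> \<noteq> {}" and ch: "subset.chain ?\<A> \<C>"
    then have "submodule (\<Union>\<C>) R M"
      by (intro submodule_Union_chain) (auto simp: subset_chain_def)
    moreover have "N \<inter> \<Union>\<C> = {\<zero>\<^bsub>M\<^esub>}" using ne ch by (auto simp: subset_chain_def)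
    ultimately show "\<Union>\<C> \<in> ?\<A>" by simp
  qed
  then obtain C where "C \<in> ?\<A>" and max: "\<forall>X\<in>?\<A>. C \<subseteq> X \<longrightarrow> X = C" ..
  then have C: "submodule C R M" "N \<inter> C = {\<zero>\<^bsub>M\<^esub>}" by simp_all
  note Cs = right_submoduleE[OF C(1)] and NC = submodule_set_add[OF N C(1)]
  have "N <+>\<^bsub>M\<^esub> C = carrier M"
  proof (rule ccontr)
    assume proper: "N <+>\<^bsub>M\<^esub> C \<noteq> carrier M"
    obtain T where T: "submodule T R M" "T \<noteq> {\<zero>\<^bsub>M\<^esub>}" "T \<inter> (N <+>\<^bsub>M\<^esub> C) = {\<zero>\<^bsub>M\<^esub>}"
      using ex_submodule_disjoint[OF R NC(1) proper] .
    note Ts = right_submoduleE[OF T(1)] and CT = submodule_set_add[OF C(1) T(1)]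
    \<comment> \<open>Enlarging \<open>C\<close> by \<open>T\<close> keeps the intersection with
      \<open>N\<close> zero: in a decomposition of \<open>z\<close> the part \<open>t\<close> is
      \<open>z\<close> minus \<open>c\<close>, so it lies in the sum of \<open>N\<close> and
      \<open>C\<close> and vanishes. Then \<open>z = c\<close> lies in both \<open>N\<close> and
      \<open>C\<close>.\<close>
    have "z = \<zero>\<^bsub>M\<^esub>" if z: "z \<in> N" "z \<in> C <+>\<^bsub>M\<^esub> T" for z
    proof -
      obtain c t where ct: "c \<in> C" "t \<in> T" "z = c \<oplus>\<^bsub>M\<^esub> t" by (rule set_addE[OF z(2)])
      have "t = z \<oplus>\<^bsub>M\<^esub> (\<ominus>\<^bsub>M\<^esub> c)"
        using ct(1,2) Cs(1) Ts(1) unfolding ct(3)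
        by (simp add: subset_iff M.a_comm[of c t] M.a_assoc M.r_neg)
      then have "t \<in> N <+>\<^bsub>M\<^esub> C" using set_addI[OF z(1) Cs(4)[OF ct(1)], of M] by simp
      then have "t = \<zero>\<^bsub>M\<^esub>" using ct(2) T(3) by blast
      then have "z = c" using ct(1,3) Cs(1) by auto
      then show ?thesis using z(1) ct(1) C(2) by blast
    qed
    then have "N \<inter> (C <+>\<^bsub>M\<^esub> T) = {\<zero>\<^bsub>M\<^esub>}"
      using Ns(2) right_submoduleE(2)[OF CT(1)] by blast
    \<comment> \<open>Maximality puts \<open>T\<close> inside \<open>C\<close>, hence inside the sum
      that it was chosen to meet trivially; this contradicts that \<open>T\<close> is
      nonzero.\<close>
    then have "C <+>\<^bsub>M\<^esub> T = C" using max CT(1,2) by simp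
    then have "T \<subseteq> N <+>\<^bsub>M\<^esub> C" using CT(3) NC(3) by blast
    then show False using T(2,3) by blast
  qed
  with C show thesis by (rule that)
qed

section \<open>Endomorphisms and quasi-inverses\<close>

lemma module_EndD:
  assumes "f \<in> carrier (End_ring R M)"
  shows "\<And>x. x \<in> carrier M \<Longrightarrow> f x \<in> carrier M"
    and "\<And>x y. x \<in> carrier M \<Longrightarrow> y \<in> carrier M \<Longrightarrow> f (x \<oplus>\<^bsub>M\<^esub> y) = f x \<oplus>\<^bsub>M\<^esub> f y"
    and "\<And>a x. a \<in> carrier R \<Longrightarrow> x \<in> carrier M \<Longrightarrow> f (a \<odot>\<^bsub>M\<^esub> x) = a \<odot>\<^bsub>M\<^esub> f x"
    and "f \<in> extensional (carrier M)"
    and "f \<zero>\<^bsub>M\<^esub> = \<zero>\<^bsub>M\<^esub>"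
proof -
  show cl: "\<And>x. x \<in> carrier M \<Longrightarrow> f x \<in> carrier M"
    and "\<And>x y. x \<in> carrier M \<Longrightarrow> y \<in> carrier M \<Longrightarrow> f (x \<oplus>\<^bsub>M\<^esub> y) = f x \<oplus>\<^bsub>M\<^esub> f y"
    and sm: "\<And>a x. a \<in> carrier R \<Longrightarrow> x \<in> carrier M \<Longrightarrow> f (a \<odot>\<^bsub>M\<^esub> x) = a \<odot>\<^bsub>M\<^esub> f x"
    and "f \<in> extensional (carrier M)"
    using assms by (auto simp: End_ring_def module_End_def PiE_iff)
  show "f \<zero>\<^bsub>M\<^esub> = \<zero>\<^bsub>M\<^esub>" using sm[of "\<zero>\<^bsub>R\<^esub>" "\<zero>\<^bsub>M\<^esub>"] cl by auto
qed

lemma End_mult_apply: "x \<in> carrier M \<Longrightarrow> (f \<otimes>\<^bsub>End_ring R M\<^esub> g) x = f (g x)"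
  by (simp add: End_ring_def compose_def)

lemma End_eqI:
  assumes "f \<in> carrier (End_ring R M)" "g \<in> carrier (End_ring R M)"
    and "\<And>x. x \<in> carrier M \<Longrightarrow> f x = g x"
  shows "f = g"
  using module_EndD(4)[OF assms(1)] module_EndD(4)[OF assms(2)] assms(3)
  by (rule extensionalityI)

text \<open>Let \<open>C\<close> be a complement of the kernel of \<open>f\<close> and
  \<open>E\<close> a complement of its image. Then \<open>f\<close> maps \<open>C\<close>
  bijectively onto its image, and \<open>p\<close> is the inverse of this bijection on the image and
  zero on \<open>E\<close>.\<close>

lemma End_quasi_inverse:
  assumes R: "semisimple_module R (regular_right_module R)"
    and f: "f \<in> carrier (End_ring R M)"
  obtains p where "p \<in> carrier (End_ring R M)"
    "f \<otimes>\<^bsub>End_ring R M\<^esub> (p \<otimes>\<^bsub>End_ring R M\<^esub> f) = f"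
proof -
  interpret S: ring "End_ring R M" by (rule ring_End_ring)
  note F = module_EndD[OF f]
  have ker: "submodule (a_kernel M M f) R M"
    by (rule right_submoduleI) (auto simp: a_kernel_def' F)
  have im: "submodule (f ` carrier M) R M"
  proof (rule right_submoduleI)
    show "\<zero>\<^bsub>M\<^esub> \<in> f ` carrier M" using F(5) by (metis M.zero_closed image_eqI)
  qed (auto simp: F(1) simp flip: F(2,3))
  obtain C where C: "submodule C R M" "a_kernel M M f \<inter> C = {\<zero>\<^bsub>M\<^esub>}"
    "a_kernel M M f <+>\<^bsub>M\<^esub> C = carrier M" using ex_complement[OF R ker] .
  obtain E where E: "submodule E R M" "f ` carrier M \<inter> E = {\<zero>\<^bsub>M\<^esub>}"
    "f ` carrier M <+>\<^bsub>M\<^esub> E = carrier M" using ex_complement[OF R im] .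
  note Cs = right_submoduleE[OF C(1)] and Es = right_submoduleE[OF E(1)]
  \<comment> \<open>Dropping the kernel component of \<open>x\<close> does not change the value of
    \<open>f\<close>.\<close>
  have lift: "\<exists>c\<in>C. f c = f x" if x: "x \<in> carrier M" for x
  proof -
    obtain k c where "k \<in> a_kernel M M f" "c \<in> C" "x = k \<oplus>\<^bsub>M\<^esub> c"
      using x unfolding C(3)[symmetric] by (elim set_addE)
    then show ?thesis using F Cs(1) by (auto simp: a_kernel_def' subset_iff)
  qed
  \<comment> \<open>The difference of \<open>c\<close> and \<open>c'\<close> lies in the kernel of
    \<open>f\<close> as well as in its complement \<open>C\<close>.\<close>
  have inj: "c = c'" if "c \<in> C" "c' \<in> C" "f c = f c'" for c c'
  proof -
    have cl: "c \<in> carrier M" "c' \<in> carrier M" using that Cs(1) by auto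
    have "f (c \<oplus>\<^bsub>M\<^esub> \<ominus>\<^bsub>M\<^esub> c') = f c' \<oplus>\<^bsub>M\<^esub> f (\<ominus>\<^bsub>M\<^esub> c')" using that cl by (simp add: F)
    also have "\<dots> = f \<zero>\<^bsub>M\<^esub>" using cl by (simp add: F(2)[symmetric] M.r_neg)
    finally have "c \<oplus>\<^bsub>M\<^esub> \<ominus>\<^bsub>M\<^esub> c' \<in> a_kernel M M f \<inter> C"
      using that cl F(5) Cs(3,4) by (auto simp: a_kernel_def')
    then have "c \<oplus>\<^bsub>M\<^esub> \<ominus>\<^bsub>M\<^esub> c' = \<zero>\<^bsub>M\<^esub>" using C(2) by simp
    from this cl show ?thesis by (rule eq_if_diff_zero)
  qed
  \<comment> \<open>Existence combines the decomposition along \<open>E\<close> with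
    \<open>lift\<close>; uniqueness combines that of the image component with
    \<open>inj\<close>.\<close>
  have dec: "\<exists>!c. c \<in> C \<and> (\<exists>e\<in>E. y = f c \<oplus>\<^bsub>M\<^esub> e)" if y: "y \<in> carrier M" for y
  proof (rule ex_ex1I)
    have "y \<in> f ` carrier M <+>\<^bsub>M\<^esub> E" using y E(3) by blast
    then obtain v e where "v \<in> f ` carrier M" "e \<in> E" "y = v \<oplus>\<^bsub>M\<^esub> e" by (rule set_addE)
    then obtain x e where "x \<in> carrier M" "e \<in> E" "y = f x \<oplus>\<^bsub>M\<^esub> e" by blast
    then show "\<exists>c. c \<in> C \<and> (\<exists>e\<in>E. y = f c \<oplus>\<^bsub>M\<^esub> e)" using lift[of x] by metis
  next
    fix c c' assume "c \<in> C \<and> (\<exists>e\<in>E. y = f c \<oplus>\<^bsub>M\<^esub> e)" "c' \<in> C \<and> (\<exists>e\<in>E. y = f c' \<oplus>\<^bsub>M\<^esub> e)"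
    then obtain e e' where "c \<in> C" "c' \<in> C" "e \<in> E" "e' \<in> E" "f c \<oplus>\<^bsub>M\<^esub> e = f c' \<oplus>\<^bsub>M\<^esub> e'" by auto
    then show "c = c'"
      using decomposition_unique(1)[OF im E(1,2), of "f c" "f c'" e e'] inj Cs(1) by blast
  qed
  define p where "p = (\<lambda>y\<in>carrier M. THE c. c \<in> C \<and> (\<exists>e\<in>E. y = f c \<oplus>\<^bsub>M\<^esub> e))"
  \<comment> \<open>By uniqueness, any decomposition of this shape determines \<open>p y\<close>.
    Additivity and linearity of \<open>p\<close> thus reduce to adding or scaling
    decompositions.\<close>
  have pI: "p y = c" if "c \<in> C" "e \<in> E" "y = f c \<oplus>\<^bsub>M\<^esub> e" for y c e
  proof -
    have "y \<in> carrier M" using that F(1) Cs(1) Es(1) by auto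
    then show ?thesis using dec[of y] that unfolding p_def by (auto intro!: the1_equality)
  qed
  have pE: "\<exists>e\<in>E. p y \<in> C \<and> y = f (p y) \<oplus>\<^bsub>M\<^esub> e" if "y \<in> carrier M" for y
  proof -
    obtain c e where *: "c \<in> C" "e \<in> E" "y = f c \<oplus>\<^bsub>M\<^esub> e" using dec[OF \<open>y \<in> carrier M\<close>] by blast
    then have "p y = c" by (rule pI)
    then show ?thesis using * by metis
  qed
  have p: "p \<in> carrier (End_ring R M)"
  proof -
    have "p \<in> carrier M \<rightarrow>\<^sub>E carrier M"
      using pE Cs(1) by (auto simp: PiE_iff) (simp add: p_def)
    moreover have "p (x \<oplus>\<^bsub>M\<^esub> y) = p x \<oplus>\<^bsub>M\<^esub> p y" if xy: "x \<in> carrier M" "y \<in> carrier M" for x y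
    proof -
      obtain e e' where *: "e \<in> E" "p x \<in> C" "x = f (p x) \<oplus>\<^bsub>M\<^esub> e"
        "e' \<in> E" "p y \<in> C" "y = f (p y) \<oplus>\<^bsub>M\<^esub> e'"
        using pE[OF xy(1)] pE[OF xy(2)] by auto
      then have cl: "p x \<in> carrier M" "p y \<in> carrier M" "e \<in> carrier M" "e' \<in> carrier M"
        using Cs(1) Es(1) by auto
      have "x \<oplus>\<^bsub>M\<^esub> y = (f (p x) \<oplus>\<^bsub>M\<^esub> e) \<oplus>\<^bsub>M\<^esub> (f (p y) \<oplus>\<^bsub>M\<^esub> e')"
        by (simp flip: *(3,6))
      also have "\<dots> = f (p x \<oplus>\<^bsub>M\<^esub> p y) \<oplus>\<^bsub>M\<^esub> (e \<oplus>\<^bsub>M\<^esub> e')" using cl by (simp add: F M.a_ac)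
      finally show ?thesis by (rule pI[OF Cs(3)[OF *(2,5)] Es(3)[OF *(1,4)]])
    qed
    moreover have "p (a \<odot>\<^bsub>M\<^esub> x) = a \<odot>\<^bsub>M\<^esub> p x" if a: "a \<in> carrier R" and x: "x \<in> carrier M" for a x
    proof -
      obtain e where *: "e \<in> E" "p x \<in> C" "x = f (p x) \<oplus>\<^bsub>M\<^esub> e"
        using pE[OF x] by auto
      then have cl: "p x \<in> carrier M" "e \<in> carrier M" using Cs(1) Es(1) by auto
      have "a \<odot>\<^bsub>M\<^esub> x = a \<odot>\<^bsub>M\<^esub> (f (p x) \<oplus>\<^bsub>M\<^esub> e)" by (simp flip: *(3))
      also have "\<dots> = f (a \<odot>\<^bsub>M\<^esub> p x) \<oplus>\<^bsub>M\<^esub> a \<odot>\<^bsub>M\<^esub> e"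
        using cl a by (simp add: F rsmult_vector_distr)
      finally show ?thesis by (rule pI[OF Cs(5)[OF a *(2)] Es(5)[OF a *(1)]])
    qed
    ultimately show ?thesis by (simp add: End_ring_def module_End_def)
  qed
  have "f (p (f x)) = f x" if x: "x \<in> carrier M" for x
  proof -
    obtain c where c: "c \<in> C" "f c = f x" using lift[OF x] by blast
    \<comment> \<open>Here the component in \<open>E\<close> is zero, since \<open>f x\<close> is
      already in the image.\<close>
    then have "p (f x) = c" using pI[of c "\<zero>\<^bsub>M\<^esub>" "f x"] Es(2) F(1) x by simp
    then show ?thesis using c by simp
  qed
  then have "f \<otimes>\<^bsub>End_ring R M\<^esub> (p \<otimes>\<^bsub>End_ring R M\<^esub> f) = f"
    using f p by (intro End_eqI) (auto simp: End_mult_apply F(1))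
  with p show thesis by (rule that)
qed

section \<open>Central idempotents and the morphic condition\<close>

text \<open>The kernel of \<open>e\<close> is the image of a central \<open>g\<close> and its image
  is the kernel of a central \<open>h\<close>, so every endomorphism \<open>s\<close> preserves
  both. As \<open>M\<close> is their direct sum and \<open>e\<close> projects onto the image along
  the kernel, \<open>s\<close> commutes with \<open>e\<close>.\<close>

lemma idempotent_central:
  assumes cqm: "centrally_quasi_morphic R M"
    and e: "e \<in> carrier (End_ring R M)" "e \<otimes>\<^bsub>End_ring R M\<^esub> e = e"
  shows "e \<in> ring_center (End_ring R M)"
proof -
  interpret S: ring "End_ring R M" by (rule ring_End_ring)
  obtain g h where gh: "g \<in> ring_center (End_ring R M)" "h \<in> ring_center (End_ring R M)"
    "a_kernel M M e = g ` carrier M" "e ` carrier M = a_kernel M M h"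
    using cqm e(1) unfolding centrally_quasi_morphic_def by blast
  note E = module_EndD[OF e(1)]
  have ee: "e (e x) = e x" if "x \<in> carrier M" for x
    using e(2) End_mult_apply[OF that, of e e] by simp
  have comm: "z (s x) = s (z x)"
    if "z \<in> ring_center (End_ring R M)" "s \<in> carrier (End_ring R M)" "x \<in> carrier M" for z s x
    using that End_mult_apply[OF that(3), of z s] End_mult_apply[OF that(3), of s z]
    by (simp add: ring_center_def)
  have "e (s x) = s (e x)" if s: "s \<in> carrier (End_ring R M)" and x: "x \<in> carrier M" for s x
  proof -
    note Sx = module_EndD[OF s]
    \<comment> \<open>The component of \<open>x\<close> in the kernel of \<open>e\<close>; the other
      component is \<open>e x\<close>.\<close>
    define k where "k = x \<ominus>\<^bsub>M\<^esub> e x"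
    have k: "k \<in> carrier M" "x = k \<oplus>\<^bsub>M\<^esub> e x"
      using x E(1) by (auto simp: k_def a_minus_def M.a_assoc M.l_neg)
    have "e k \<oplus>\<^bsub>M\<^esub> e x = e x" using k x E(1) E(2)[of k "e x"] ee by simp
    then have "k \<in> a_kernel M M e" using k x E(1) by (simp add: a_kernel_def')
    then obtain y where y: "y \<in> carrier M" "k = g y" using gh(3) by auto
    \<comment> \<open>Centrality of \<open>g\<close> makes its image, the kernel of
      \<open>e\<close>, stable under \<open>s\<close>.\<close>
    have "s k = g (s y)" using comm[OF gh(1) s] y by simp
    then have "s k \<in> a_kernel M M e" using gh(3) y Sx(1) by auto
    then have esk: "e (s k) = \<zero>\<^bsub>M\<^esub>" by (simp add: a_kernel_def')
    have "e x \<in> a_kernel M M h" using gh(4) x by auto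
    \<comment> \<open>Centrality of \<open>h\<close> makes its kernel, the image of
      \<open>e\<close>, stable under \<open>s\<close>. Elements of that image are fixed by
      \<open>e\<close>.\<close>
    then have "h (s (e x)) = \<zero>\<^bsub>M\<^esub>"
      using comm[OF gh(2) s] Sx(5) x E(1) by (simp add: a_kernel_def')
    then have "s (e x) \<in> e ` carrier M" using gh(4) Sx(1) E(1) x by (simp add: a_kernel_def')
    then have "e (s (e x)) = s (e x)" using ee by auto
    moreover have "e (s x) = e (s k) \<oplus>\<^bsub>M\<^esub> e (s (e x))"
      using k x Sx E by (metis (no_types))
    ultimately show ?thesis using esk Sx(1) E(1) x by simp
  qed
  then show ?thesis
    unfolding ring_center_def using e(1)
    by (auto intro!: End_eqI simp: End_mult_apply module_EndD(1))
qed

lemma centrally_quasi_morphic_imp_centrally_morphic: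
  assumes R: "semisimple_module R (regular_right_module R)"
    and cqm: "centrally_quasi_morphic R M"
  shows "centrally_morphic R M"
  unfolding centrally_morphic_def
proof
  interpret S: ring "End_ring R M" by (rule ring_End_ring)
  let ?S = "End_ring R M"
  fix f assume f: "f \<in> carrier ?S"
  obtain p where p: "p \<in> carrier ?S" "f \<otimes>\<^bsub>?S\<^esub> (p \<otimes>\<^bsub>?S\<^esub> f) = f"
    using End_quasi_inverse[OF R f] .
  define e where "e = p \<otimes>\<^bsub>?S\<^esub> f"
  define e' where "e' = f \<otimes>\<^bsub>?S\<^esub> p"
  have cl: "e \<in> carrier ?S" "e' \<in> carrier ?S" using f p by (auto simp: e_def e'_def)
  have fe: "f \<otimes>\<^bsub>?S\<^esub> e = f" "e' \<otimes>\<^bsub>?S\<^esub> f = f" using p f by (auto simp: e_def e'_def S.m_assoc)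
  have idem: "e \<otimes>\<^bsub>?S\<^esub> e = e" "e' \<otimes>\<^bsub>?S\<^esub> e' = e'"
    using fe f p cl by (metis S.m_assoc e_def, metis S.m_assoc e'_def)
  have "e' \<in> ring_center ?S" "e \<in> ring_center ?S"
    using idempotent_central[OF cqm] cl idem by auto
  then have comm: "e' \<otimes>\<^bsub>?S\<^esub> f = f \<otimes>\<^bsub>?S\<^esub> e'" "e \<otimes>\<^bsub>?S\<^esub> f = f \<otimes>\<^bsub>?S\<^esub> e"
    using f by (auto simp: ring_center_def)
  \<comment> \<open>The product of \<open>e\<close> and \<open>e'\<close> is evaluated in two ways:
    moving \<open>e\<close> past \<open>f\<close> absorbs \<open>e\<close> and leaves
    \<open>e'\<close>, while moving \<open>e'\<close> past \<open>f\<close> absorbs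
    \<open>e'\<close> and leaves \<open>e\<close>.\<close>
  have "e \<otimes>\<^bsub>?S\<^esub> e' = (e \<otimes>\<^bsub>?S\<^esub> f) \<otimes>\<^bsub>?S\<^esub> p" using f p cl by (simp add: e'_def S.m_assoc)
  also have "\<dots> = e'" using comm fe by (simp add: e'_def)
  moreover have "e \<otimes>\<^bsub>?S\<^esub> e' = p \<otimes>\<^bsub>?S\<^esub> (f \<otimes>\<^bsub>?S\<^esub> e')" using f p cl by (simp add: e_def S.m_assoc)
  moreover have "\<dots> = e" using comm(1) fe(2) by (simp add: e_def)
  ultimately have ee': "e = e'" by simp
  \<comment> \<open>The complementary idempotent has image the kernel of \<open>e\<close> and kernel
    the image of \<open>e\<close>. It remains to see that \<open>e\<close> and \<open>f\<close>
    share kernel and image.\<close>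
  define g where "g = \<one>\<^bsub>?S\<^esub> \<ominus>\<^bsub>?S\<^esub> e"
  have g: "g \<in> carrier ?S" using cl by (simp add: g_def)
  have "g \<otimes>\<^bsub>?S\<^esub> g = g"
    using cl idem by (simp add: g_def a_minus_def S.l_distr S.r_distr S.l_minus S.r_minus
        S.a_ac S.r_neg S.l_neg S.r_neg1)
  then have gc: "g \<in> ring_center ?S" using idempotent_central[OF cqm] g by auto
  have "g \<oplus>\<^bsub>?S\<^esub> e = \<one>\<^bsub>?S\<^esub>" using cl by (simp add: g_def a_minus_def S.a_assoc S.l_neg)
  then have split: "g x \<oplus>\<^bsub>M\<^esub> e x = x" if "x \<in> carrier M" for x
    using that by (auto simp: End_ring_def fun_eq_iff restrict_def split: if_splits)
  note F = module_EndD[OF f] and G = module_EndD[OF g] and E = module_EndD[OF cl(1)]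
    and P = module_EndD[OF p(1)]
  \<comment> \<open>The form \<open>p (f x)\<close> controls the kernel of \<open>f\<close>. The
    form \<open>f (p x)\<close>, available because \<open>e = e'\<close>, controls the
    image.\<close>
  have ex: "e x = p (f x)" "e x = f (p x)" "f (e x) = f x" "e (e x) = e x" if "x \<in> carrier M" for x
    using that End_mult_apply[OF that, of p f] End_mult_apply[OF that, of f p] ee'
      End_mult_apply[OF that, of f e] fe End_mult_apply[OF that, of e e] idem
    by (auto simp: e_def[symmetric] e'_def[symmetric])
  have "a_kernel M M f = g ` carrier M"
  proof
    show "a_kernel M M f \<subseteq> g ` carrier M"
    proof
      fix x assume "x \<in> a_kernel M M f"
      then have x: "x \<in> carrier M" "f x = \<zero>\<^bsub>M\<^esub>" by (auto simp: a_kernel_def')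
      then have "g x = x" using split[of x] ex(1)[of x] P(5) G(1) by simp
      then show "x \<in> g ` carrier M" using x by (metis image_eqI)
    qed
    show "g ` carrier M \<subseteq> a_kernel M M f"
    proof
      fix y assume "y \<in> g ` carrier M"
      then obtain x where x: "x \<in> carrier M" "y = g x" by auto
      have "f (g x) \<oplus>\<^bsub>M\<^esub> f x = f x"
        using split[OF x(1)] F(2)[of "g x" "e x"] ex(3)[OF x(1)] G(1) E(1) x(1) by simp
      then show "y \<in> a_kernel M M f" using x F(1) G(1) by (simp add: a_kernel_def')
    qed
  qed
  moreover have "f ` carrier M = a_kernel M M g"
  proof
    show "f ` carrier M \<subseteq> a_kernel M M g"
    proof
      fix y assume "y \<in> f ` carrier M"
      then obtain x where x: "x \<in> carrier M" "y = f x" by auto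
      \<comment> \<open>Since \<open>e\<close> commutes with \<open>f\<close> and is absorbed by it
        on the right, it fixes the image of \<open>f\<close> pointwise.\<close>
      have "e y = y"
        using comm(2) fe(1) x End_mult_apply[OF x(1), of e f] by simp
      then have "g y \<oplus>\<^bsub>M\<^esub> y = y" using split[of y] x F(1) by simp
      then show "y \<in> a_kernel M M g" using x F(1) G(1) by (simp add: a_kernel_def')
    qed
    show "a_kernel M M g \<subseteq> f ` carrier M"
    proof
      fix y assume "y \<in> a_kernel M M g"
      then have y: "y \<in> carrier M" "g y = \<zero>\<^bsub>M\<^esub>" by (auto simp: a_kernel_def')
      then have "f (p y) = y" using split[of y] ex(2)[of y] E(1)[of y] by simp
      then show "y \<in> f ` carrier M" using y P(1) by (metis image_eqI)
    qed
  qed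
  ultimately show "\<exists>g\<in>ring_center ?S.
      a_kernel M M f = g ` carrier M \<and> f ` carrier M = a_kernel M M g"
    using gc by blast
qed

end

theorem corollary3p21:
  fixes R :: "('a, 'r) ring_scheme" and M :: "('a, 'b, 'm) module_scheme"
  assumes "semisimple_artinian_ring R"
    and "right_module R M"
    and "finitely_generated_module R M"
  shows "centrally_morphic R M \<longleftrightarrow> centrally_quasi_morphic R M"
proof
  \<comment> \<open>The single central witness serves as both \<open>g\<close> and
    \<open>h\<close>.\<close>
  show "centrally_quasi_morphic R M" if "centrally_morphic R M"
    using that unfolding centrally_morphic_def centrally_quasi_morphic_def by blast
  show "centrally_morphic R M" if "centrally_quasi_morphic R M"
    using assms(1) right_module.centrally_quasi_morphic_imp_centrally_morphic[OF assms(2) _ that]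
    by (simp add: semisimple_artinian_ring_def)
qed

end
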